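(* For every integer $n\ge 0$, \begin{align*} H_{6n}( G(x,6)) &=H_{6n+1}( G(x,6))=(-1)^n,\\ H_{6n+2}( G(x,6)) &=(-1)^n( n+1 )( 144n^{2}+72n-19 ),\\ H_{6n+3}( G(x,6)) &=- H_{6n+4}( G(x,6))=(-1)^{n+1}144(n+1)^2,\\ H_{6n+5}( G(x,6)) &=(-1)^{n}( n+1 )( 144n^{2}+504n+413 ). \end{align*}
   Context: For a power series $A(x)=\sum_{n\ge 0}a_nx^n$, the Hankel determinants are $H_n(A(x))=\det(a_{i+j})_{0\le i,j\le n-1}$ for $n\ge 1$, with $H_0(A(x))=1$. For a nonnegative integer $r$, $G(x,r)=\sum_{n\ge 0}\binom{2n+r}{n}x^n$; equivalently $G(x,r)=\frac{C(x)^r}{1-2xC(x)}=\frac{C(x)^r}{\sqrt{1-4x}}$, where $C(x)=\sum_{n\ge0}\frac1{n+1}\binom{2n}{n}x^n$. *)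

theory Defs
  imports
    "HOL-Computational_Algebra.Formal_Power_Series"
    "Jordan_Normal_Form.Determinant"
begin

definition hankel_det :: "nat \<Rightarrow> 'a :: comm_ring_1 fps \<Rightarrow> 'a" where
  "hankel_det n A = det (mat n n (\<lambda>(i, j). fps_nth A (i + j)))"

lemma hankel_det_0 [simp]: "hankel_det 0 A = 1"
  by (simp add: hankel_det_def det_def)

definition G :: "nat \<Rightarrow> int fps" where
  "G r = Abs_fps (\<lambda>n. int ((2 * n + r) choose n))"

end

theory Submission
  imports Defs
begin

text \<open>
  Put \<open>y = z + 2 + 1/z = (1 + z)\<^sup>2 / z\<close> and write \<open>CT\<close> for the constant term in \<open>z\<close>.  The
  coefficient \<open>2n+r choose n\<close> is \<open>CT (y\<^sup>n (1 + z)\<^sup>r)\<close>, so the coefficients of \<open>G(x, r)\<close> are the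
  moments in \<open>y\<close> of a linear functional with a Laurent polynomial density.  A Hankel determinant does
  not change when the powers of \<open>y\<close> are replaced by other monic polynomials.  The choice
  \<open>p\<^sub>k = (z\<^bsup>k+1/2\<^esup> + z\<^bsup>-k-1/2\<^esup>) / (z\<^bsup>1/2\<^esup> + z\<^bsup>-1/2\<^esup>)\<close> (Chebyshev polynomials of the third kind) is
  the right one, because these are orthogonal for the density \<open>y\<close> and
  \<open>(1 + z)\<^sup>r = y (1 + z)\<^bsup>r-2\<^esup> z\<close>: the Gram matrix of the \<open>p\<^sub>k\<close> is a banded sum
  \<open>d (k - l) + d (k + l + 1)\<close> of a Toeplitz and a Hankel matrix, where \<open>d m\<close> is the coefficient of
  \<open>z\<^sup>m\<close> in the symmetrised Laurent polynomial \<open>(1 + z)\<^bsup>r-2\<^esup> z + (1 + 1/z)\<^bsup>r-2\<^esup> / z\<close>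
  (\<open>hankel_det_G\<close>, for \<open>r \<ge> 2\<close>).

  The leading minors of a matrix of upper bandwidth \<open>m\<close> with ones on the outermost diagonal are
  governed by its \<open>m\<close>-dimensional kernel: up to sign, the minor of order \<open>n\<close> is the quotient of
  the \<open>m \<times> m\<close> determinants formed by the entries of a basis of the kernel at the positions
  \<open>n, ..., n + m - 1\<close> and \<open>0, ..., m - 1\<close> (\<open>det_banded\<close>).  For \<open>r = 6\<close> the bandwidth is 5,
  and the convolution with \<open>d\<close> has the characteristic polynomial \<open>(z + 1)\<^sup>4 (z\<^sup>6 + 1)\<close>.
  Its solutions that are symmetric about
  \<open>-1/2\<close> are spanned by three sequences with \<open>v (k + 6) = - v k\<close>, coming from \<open>z\<^sup>6 + 1\<close>, and by
  \<open>(-1)\<^sup>k (2k + 1)\<close> and \<open>(-1)\<^sup>k (2k + 1) k (k + 1)\<close>, coming from the multiple root \<open>-1\<close>.  The first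
  three account for the dependence on \<open>n mod 6\<close>, the last two for the polynomial growth.  What is
  left is a \<open>5 \<times> 5\<close> determinant for each residue of \<open>n\<close> modulo 6 (\<open>window_values\<close>).
\<close>

section \<open>Powers of y in the basis of third-kind Chebyshev polynomials\<close>

text \<open>
  Since \<open>(z\<^bsup>1/2\<^esup> + z\<^bsup>-1/2\<^esup>)\<^bsup>2i+1\<^esup> = \<Sum>\<^sub>k (2i+1 choose i-k) (z\<^bsup>k+1/2\<^esup> + z\<^bsup>-k-1/2\<^esup>)\<close>, the weights below
  are the coordinates of \<open>y\<^sup>i\<close> in the basis \<open>p\<^sub>k\<close>.  So this is the value at \<open>y\<^sup>i\<close> of the linear
  functional that sends \<open>p\<^sub>k\<close> to \<open>f k\<close>.
\<close>
definition moment :: "nat \<Rightarrow> (nat \<Rightarrow> 'a :: comm_ring_1) \<Rightarrow> 'a" where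
  "moment i f = (\<Sum>k\<le>i. of_nat ((2 * i + 1) choose (i - k)) * f k)"

lemma moment_add: "moment i (\<lambda>k. f k + g k) = moment i f + moment i g"
  by (simp add: moment_def sum.distrib algebra_simps)

lemma moment_mult_left: "moment i (\<lambda>k. a * f k) = a * moment i f"
  by (simp add: moment_def sum_distrib_left algebra_simps)

lemma moment_swap:
  "moment i (\<lambda>k. moment j (g k)) = moment j (\<lambda>l. moment i (\<lambda>k. g k l))"
  unfolding moment_def sum_distrib_left
  by (subst sum.swap) (simp add: algebra_simps)

lemma choose_two_up:
  "(n + 2) choose (Suc (Suc k)) = (n choose k) + 2 * (n choose Suc k) + (n choose Suc (Suc k))"
  by (simp add: numeral_2_eq_2)

text \<open>
  This is \<open>y\<^bsup>i+1\<^esup> = y\<^sup>i y\<close> together with \<open>y p\<^sub>k = p\<^bsub>k+1\<^esub> + 2 p\<^sub>k + p\<^bsub>k-1\<^esub>\<close>.  The basis satisfies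
  \<open>p\<^bsub>-1\<^esub> = p\<^sub>0\<close>, which is exactly what the truncated subtraction in \<open>f (k - 1)\<close> gives at \<open>k = 0\<close>.
\<close>
lemma moment_Suc:
  "moment (Suc i) f = moment i (\<lambda>k. f (k + 1) + 2 * f k + f (k - 1))"
proof -
  define c :: "nat \<Rightarrow> nat \<Rightarrow> 'a"
    where "c i k = (if k \<le> i then of_nat ((2 * i + 1) choose (i - k)) else 0)" for i k
  have moment_c: "moment i f = (\<Sum>k\<le>i + d. c i k * f k)" for i d f
    unfolding moment_def c_def by (rule sum.mono_neutral_cong_left) auto
  have c_Suc: "c (Suc i) k = c i (k + 1) + 2 * c i k + c i (k - 1)" for k
  proof (cases "k < i")
    case True
    then obtain e where e: "i = Suc k + e"
      by (metis less_iff_Suc_add add_Suc)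
    let ?N = "2 * i + 1"
    have "c (Suc i) k = of_nat ((?N + 2) choose Suc (Suc e))"
      using e by (simp add: c_def Suc_diff_le)
    moreover have "c i (k + 1) = of_nat (?N choose e)" "c i k = of_nat (?N choose Suc e)"
      using e by (simp_all add: c_def)
    moreover have "c i (k - 1) = of_nat (?N choose Suc (Suc e))"
    proof (cases k)
      case 0
      \<comment> \<open>The two middle binomial coefficients of the odd row agree; this is \<open>p\<^bsub>-1\<^esub> = p\<^sub>0\<close>.\<close>
      have "?N choose Suc e = ?N choose Suc (Suc e)"
        using binomial_symmetric[of "Suc e" ?N] e 0 by simp
      then show ?thesis using e 0 by (simp add: c_def)
    next
      case (Suc k')
      then show ?thesis using e by (simp add: c_def)
    qed
    moreover have "(of_nat ((?N + 2) choose Suc (Suc e)) :: 'a) =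
        of_nat (?N choose e) + 2 * of_nat (?N choose Suc e) + of_nat (?N choose Suc (Suc e))"
      by (simp only: choose_two_up of_nat_add of_nat_mult of_nat_numeral)
    ultimately show ?thesis
      by (simp only: ac_simps)
  next
    case False
    consider "k = i" | "k = i + 1" | "k > i + 1" using False by linarith
    then show ?thesis
    proof cases
      case 1
      then show ?thesis by (cases i) (auto simp: c_def algebra_simps)
    qed (auto simp: c_def)
  qed
  have "moment (Suc i) f = (\<Sum>k\<le>Suc i. c (Suc i) k * f k)"
    using moment_c[of "Suc i" f 0] by simp
  also have "\<dots> = (\<Sum>k\<le>Suc i. c i (k + 1) * f k) + (\<Sum>k\<le>Suc i. 2 * c i k * f k) +
      (\<Sum>k\<le>Suc i. c i (k - 1) * f k)"
    by (simp only: c_Suc sum.distrib distrib_right)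
  also have "(\<Sum>k\<le>Suc i. c i (k + 1) * f k) = (\<Sum>k\<le>Suc (Suc i). c i k * f (k - 1)) - c i 0 * f 0"
    by (subst sum.atMost_Suc_shift[of _ "Suc i"]) simp
  also have "(\<Sum>k\<le>Suc i. c i (k - 1) * f k) = c i 0 * f 0 + (\<Sum>k\<le>i. c i k * f (k + 1))"
    by (subst sum.atMost_Suc_shift) simp
  also have "(\<Sum>k\<le>Suc (Suc i). c i k * f (k - 1)) = moment i (\<lambda>k. f (k - 1))"
    using moment_c[of i "\<lambda>k. f (k - 1)" 2] by simp
  also have "(\<Sum>k\<le>Suc i. 2 * c i k * f k) = moment i (\<lambda>k. 2 * f k)"
    using moment_c[of i "\<lambda>k. 2 * f k" 1] by (simp add: algebra_simps)
  also have "(\<Sum>k\<le>i. c i k * f (k + 1)) = moment i (\<lambda>k. f (k + 1))"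
    using moment_c[of i "\<lambda>k. f (k + 1)" 0] by simp
  finally show ?thesis
    by (simp add: moment_add)
qed

section \<open>Hankel determinants as determinants of folded Toeplitz matrices\<close>

text \<open>
  The Gram matrix \<open>CT (p\<^sub>k p\<^sub>l y D / 2)\<close> for an even density \<open>D = \<Sum>\<^sub>m d m z\<^sup>m\<close>: the Toeplitz matrix of
  \<open>D\<close> on all integers, restricted to sequences invariant under the reflection \<open>k \<mapsto> -1 - k\<close>.
\<close>
definition folded :: "(int \<Rightarrow> 'a :: comm_ring_1) \<Rightarrow> nat \<Rightarrow> nat \<Rightarrow> 'a" where
  "folded d k l = d (int k - int l) + d (int k + int l + 1)"

text \<open>
  Multiplication by \<open>y\<close> is self-adjoint for the form with Gram matrix \<open>folded d\<close>.
\<close>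
lemma folded_laplacian_symmetric:
  assumes even: "\<And>m. d (- m) = d m"
  shows "folded d (k + 1) l + 2 * folded d k l + folded d (k - 1) l =
    folded d k (l + 1) + 2 * folded d k l + folded d k (l - 1)"
proof -
  have e: "d (int l - int k - 1) = d (int k - int l + 1)" "d (int l - int k + 1) = d (int k - int l - 1)"
     "d (int l - int k) = d (int k - int l)"
    "d (- 1 - int l) = d (int l + 1)" "d (- int l) = d (int l)"  "d (1 - int l) = d (int l - 1)"
    "d (- 1 - int k) = d (int k + 1)" "d (- int k) = d (int k)"  "d (1 - int k) = d (int k - 1)"
    using even[of "int k - int l + 1"] even[of "int k - int l - 1"] even[of "int k - int l"]
     even[of "int l + 1"]  even[of "int l - 1"] even[of "int l"]
     even[of "int k + 1"]  even[of "int k - 1"] even[of "int k"]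
    by (simp_all add: algebra_simps)
  show ?thesis
    by (cases k; cases l) (use e in \<open>simp_all add: folded_def algebra_simps\<close>)
qed

text \<open>
  The value of the form at \<open>y\<^sup>i\<close> and \<open>y\<^sup>j\<close> depends only on \<open>i + j\<close>: self-adjointness moves the factors
  \<open>y\<close> one by one from the second argument to the first.
\<close>
lemma moment_folded:
  assumes even: "\<And>m. d (- m) = d m"
  shows "moment i (\<lambda>k. moment j (folded d k)) = moment (i + j) (\<lambda>k. folded d k 0)"
proof (induction j arbitrary: i)
  case 0
  show ?case by (simp add: moment_def)
next
  case (Suc j)
  have "moment i (\<lambda>k. moment (Suc j) (folded d k)) =
      moment i (\<lambda>k. moment j (\<lambda>l. folded d (k + 1) l + 2 * folded d k l + folded d (k - 1) l))"
    by (simp only: moment_Suc folded_laplacian_symmetric[of d, OF even])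
  also have "\<dots> = moment (Suc i) (\<lambda>k. moment j (folded d k))"
    by (simp only: moment_Suc moment_add moment_mult_left)
  finally show ?case using Suc.IH by simp
qed

text \<open>
  The Hankel matrix is \<open>L N L\<^sup>T\<close>, where \<open>N\<close> is the folded matrix and the rows of the unitriangular
  matrix \<open>L\<close> hold the coordinates of the powers of \<open>y\<close>.
\<close>
lemma hankel_det_eq_folded_det:
  assumes even: "\<And>m. d (- m) = d m"
    and moments: "\<And>n. fps_nth A n = moment n (\<lambda>k. folded d k 0)"
  shows "hankel_det n A = det (mat n n (\<lambda>(i, j). folded d i j))"
proof -
  define c :: "nat \<Rightarrow> nat \<Rightarrow> 'a"
    where "c i k = (if k \<le> i then of_nat ((2 * i + 1) choose (i - k)) else 0)" for i k
  define L where "L = mat n n (\<lambda>(i, k). c i k)"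
  define N where "N = mat n n (\<lambda>(i, j). folded d i j)"
  have L: "L \<in> carrier_mat n n" and N: "N \<in> carrier_mat n n"
    by (simp_all add: L_def N_def)
  have moment_c: "moment i f = (\<Sum>k = 0..<n. c i k * f k)" if "i < n" for i f
    unfolding moment_def c_def by (rule sum.mono_neutral_cong_left) (use that in auto)
  have "mat n n (\<lambda>(i, j). fps_nth A (i + j)) = L * N * L\<^sup>T"
  proof (rule eq_matI, goal_cases)
    case (1 i j)
    then have ij: "i < n" "j < n" using L N by auto
    have "fps_nth A (i + j) = moment j (\<lambda>l. moment i (\<lambda>k. folded d k l))"
      by (simp add: moments moment_folded[of d, OF even, symmetric] moment_swap[of i])
    also have "\<dots> = (\<Sum>l = 0..<n. (\<Sum>k = 0..<n. c i k * folded d k l) * c j l)"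
      using ij by (simp add: moment_c mult.commute)
    finally show ?case
      using ij by (simp add: L_def N_def scalar_prod_def)
  qed (use L N in auto)
  moreover have "det L = 1"
  proof -
    have "det L = prod_list (diag_mat L)"
      by (rule det_lower_triangular[OF _ L]) (auto simp: L_def c_def)
    also have "diag_mat L = map (\<lambda>_. 1) [0..<n]"
      by (auto simp: diag_mat_def L_def c_def)
    finally show ?thesis by (simp add: map_replicate_const)
  qed
  ultimately show ?thesis
    unfolding hankel_det_def N_def[symmetric]
    using det_mult[OF mult_carrier_mat[OF L N], of "L\<^sup>T"] det_mult[OF L N] det_transpose[OF L] L
    by simp
qed

text \<open>
  The coefficients of \<open>(1 + z)\<^sup>r z + (1 + 1/z)\<^sup>r / z\<close>, supported on \<open>1 \<le> \<bar>m\<bar> \<le> r + 1\<close>.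
\<close>
definition band :: "nat \<Rightarrow> int \<Rightarrow> int" where
  "band r m = (if m = 0 then 0 else int (r choose (nat \<bar>m\<bar> - 1)))"

text \<open>
  Column 0 of the folded matrix is \<open>r + 1 choose k\<close> by Pascal's rule, and its moments are then
  Vandermonde convolutions.
\<close>
lemma hankel_det_G:
  "hankel_det n (G (r + 2)) = det (mat n n (\<lambda>(i, j). folded (band r) i j))"
proof (rule hankel_det_eq_folded_det)
  fix n
  have col: "folded (band r) k 0 = int ((r + 1) choose k)" for k
    by (cases k) (auto simp: folded_def band_def nat_add_distrib)
  have "(\<Sum>k\<le>n. ((r + 1) choose k) * ((2 * n + 1) choose (n - k))) = (2 * n + (r + 2)) choose n"
    by (subst vandermonde) (simp add: algebra_simps)
  then show "fps_nth (G (r + 2)) n = moment n (\<lambda>k. folded (band r) k 0)"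
    unfolding G_def fps_nth_Abs_fps moment_def col
    by (simp add: mult.commute flip: of_nat_mult of_nat_sum)
qed (simp add: band_def)

section \<open>Leading minors of a banded matrix from its kernel\<close>

text \<open>
  Extend the leading \<open>n \<times> n\<close> block of \<open>M\<close> to \<open>n + m\<close> columns and complete it by the last \<open>m\<close>
  unit rows to a matrix \<open>E\<close> with the same determinant.  Replacing the first \<open>m\<close> columns of the
  identity by the kernel vectors gives a matrix \<open>W\<close>.  In \<open>E W\<close> the kernel vectors survive only in
  the last \<open>m\<close> rows, and the remaining columns of the first \<open>n\<close> rows form a unitriangular block, as
  the band of \<open>M\<close> ends with ones.  The sign comes from exchanging the two groups of rows.
\<close>
lemma det_banded:
  fixes M :: "nat \<Rightarrow> nat \<Rightarrow> 'a :: idom" and v :: "nat \<Rightarrow> nat \<Rightarrow> 'a"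
  assumes leading: "\<And>i. M i (i + m) = 1"
    and band: "\<And>i j. i + m < j \<Longrightarrow> M i j = 0"
    and null: "\<And>i k. k < m \<Longrightarrow> (\<Sum>j\<le>i + m. M i j * v k j) = 0"
  shows "det (mat n n (\<lambda>(i, j). M i j)) * det (mat m m (\<lambda>(j, k). v k j)) =
    (-1) ^ (m * n) * det (mat m m (\<lambda>(j, k). v k (n + j)))"
proof -
  define E where "E = four_block_mat (mat n n (\<lambda>(i, j). M i j)) (mat n m (\<lambda>(i, j). M i (n + j)))
    (0\<^sub>m m n) (1\<^sub>m m)"
  define W where "W = four_block_mat (mat m m (\<lambda>(j, k). v k j)) (0\<^sub>m m n)
    (mat n m (\<lambda>(j, k). v k (m + j))) (1\<^sub>m n)"
  define T where "T = mat n n (\<lambda>(i, k). M i (m + k))"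
  define B where "B = mat m n (\<lambda>(i, k). if n + i = m + k then 1 else 0 :: 'a)"
  define V where "V = mat m m (\<lambda>(j, k). v k (n + j))"
  define P where "P = four_block_mat V B (0\<^sub>m n m) T"
  have E: "E \<in> carrier_mat (n + m) (n + m)" and W: "W \<in> carrier_mat (n + m) (n + m)"
    by (auto simp: E_def W_def)
  have E_nth: "E $$ (i, j) = (if i < n then M i j else if i = j then 1 else 0)"
    if "i < n + m" "j < n + m" for i j
    using that by (auto simp: E_def)
  have W_nth: "W $$ (j, k) = (if k < m then v k j else if j = k then 1 else 0)"
    if "j < n + m" "k < n + m" for j k
    using that by (auto simp: W_def)
  have EW_nth: "(E * W) $$ (i, k) =
    (if i < n then if k < m then 0 else M i k else if k < m then v k i else if i = k then 1 else 0)"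
    if ik: "i < n + m" "k < n + m" for i k
  proof -
    have "(E * W) $$ (i, k) = (\<Sum>j = 0..<n + m. E $$ (i, j) * W $$ (j, k))"
      using that E W by (simp add: scalar_prod_def)
    also have "\<dots> = (\<Sum>j = 0..<n + m. (if i < n then M i j else if i = j then 1 else 0) *
        (if k < m then v k j else if j = k then 1 else 0))"
      using that by (intro sum.cong) (auto simp: E_nth W_nth)
    also have "\<dots> = (if i < n then if k < m then 0 else M i k
        else if k < m then v k i else if i = k then 1 else 0)"
    proof (cases "i < n \<and> k < m")
      case True
      have "(\<Sum>j = 0..<n + m. M i j * v k j) = (\<Sum>j\<le>i + m. M i j * v k j)"
        by (rule sum.mono_neutral_right) (use True band in auto)
      then show ?thesis using True null by simp
    next
      case False
      then show ?thesis
        using ik by (auto simp: if_distrib[of "\<lambda>x. x * _"] if_distrib[of "\<lambda>x. _ * x"] cong: if_cong)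
    qed
    finally show ?thesis .
  qed
  have EW: "E * W \<in> carrier_mat (n + m) (n + m)" using E W by simp
  have "det (E * W) = (-1) ^ (n * m) * det (mat (n + m) (n + m) (\<lambda>(i, j).
      (E * W) $$ (if i < m then i + n else if i < n + m then i - m else i, j)))"
    by (rule det_swap_initial_rows[OF EW]) simp
  also have "mat (n + m) (n + m) (\<lambda>(i, j).
      (E * W) $$ (if i < m then i + n else if i < n + m then i - m else i, j)) = P"
    by (rule eq_matI) (auto simp: P_def V_def B_def T_def EW_nth add.commute)
  also have "det P = det V * det T"
    unfolding P_def
    by (rule det_four_block_mat_lower_left_zero[of _ m _ n]) (auto simp: V_def B_def T_def)
  also have "det T = 1"
  proof -
    have "det T = prod_list (diag_mat T)"
      by (rule det_lower_triangular[of n]) (auto simp: T_def band)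
    also have "diag_mat T = map (\<lambda>_. 1) [0..<n]"
      by (auto simp: diag_mat_def T_def leading add.commute[of m])
    finally show ?thesis by (simp add: map_replicate_const)
  qed
  also have "det (E * W) = det (mat n n (\<lambda>(i, j). M i j)) * det (mat m m (\<lambda>(j, k). v k j))"
  proof -
    have "det E = det (mat n n (\<lambda>(i, j). M i j)) * det (1\<^sub>m m)"
      unfolding E_def by (rule det_four_block_mat_lower_left_zero[of _ n _ m]) auto
    moreover have "det W = det (mat m m (\<lambda>(j, k). v k j)) * det (1\<^sub>m n)"
      unfolding W_def by (rule det_four_block_mat_upper_right_zero[of _ m _ n]) auto
    ultimately show ?thesis using det_mult[OF E W] by simp
  qed
  finally show ?thesis by (simp add: V_def mult.commute)
qed

section \<open>Kernel vectors of the folded matrix for r = 6\<close>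

text \<open>
  On reflection-invariant sequences the folded matrix acts as convolution on the integers: its
  Hankel part is the contribution of the negative positions \<open>-1 - j\<close>.  Kernel vectors can
  therefore be read off from a linear recurrence with constant coefficients.
\<close>
lemma sum_folded_eq_convolution:
  fixes d v :: "int \<Rightarrow> 'a :: comm_ring_1"
  assumes supp: "\<And>m. \<bar>m\<bar> > int b \<Longrightarrow> d m = 0"
    and even: "\<And>m. d (- m) = d m" and sym: "\<And>k. v (- 1 - k) = v k"
  shows "(\<Sum>j\<le>i + b. folded d i j * v (int j)) = (\<Sum>m = - int b..int b. d m * v (int i + m))"
proof -
  let ?g = "\<lambda>j. d (int i - j) * v j"
  have bij1: "bij_betw int {..i + b} {0..int (i + b)}"
    by (rule bij_betwI[where g = nat]) auto
  have bij2: "bij_betw (\<lambda>j. - 1 - int j) {..i + b} {- 1 - int (i + b)..-1}"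
    by (rule bij_betwI[where g = "\<lambda>j. nat (- 1 - j)"]) auto
  have bij3: "bij_betw (\<lambda>m. int i + m) {- int b..int b} {int i - int b..int i + int b}"
    by (rule bij_betwI[where g = "\<lambda>j. j - int i"]) auto
  have s1: "(\<Sum>j\<le>i + b. d (int i - int j) * v (int j)) = sum ?g {0..int (i + b)}"
    by (rule sum.reindex_bij_betw[OF bij1])
  have "(\<Sum>j\<le>i + b. d (int i + int j + 1) * v (int j)) = (\<Sum>j\<le>i + b. ?g (- 1 - int j))"
    by (simp add: sym algebra_simps)
  also have "\<dots> = sum ?g {- 1 - int (i + b)..-1}"
    by (rule sum.reindex_bij_betw[OF bij2])
  finally have "(\<Sum>j\<le>i + b. folded d i j * v (int j)) =
      sum ?g {0..int (i + b)} + sum ?g {- 1 - int (i + b)..-1}"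
    by (simp add: folded_def distrib_right sum.distrib s1)
  also have "\<dots> = sum ?g {- 1 - int (i + b)..int (i + b)}"
    by (subst sum.union_disjoint[symmetric]) (auto intro!: sum.cong)
  also have "\<dots> = sum ?g {int i - int b..int i + int b}"
    by (rule sum.mono_neutral_right) (use supp in \<open>auto simp: not_le\<close>)
  also have "\<dots> = (\<Sum>m = - int b..int b. ?g (int i + m))"
    by (rule sum.reindex_bij_betw[OF bij3, symmetric])
  finally show ?thesis by (simp add: even)
qed

text \<open>
  The even solution of \<open>v (k + 6) = - v k\<close> supported on the multiples of 6.  Symmetrising its
  translates about \<open>-1/2\<close> gives the kernel vectors that belong to the factor \<open>z\<^sup>6 + 1\<close>.
\<close>
definition spike :: "int \<Rightarrow> int" where
  "spike k = (if 12 dvd k then 1 else if 12 dvd (k + 6) then - 1 else 0)"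

lemma spike_minus: "spike (- k) = spike k"
  unfolding spike_def by presburger

lemma spike_add_6: "spike (k + 6) = - spike k"
  unfolding spike_def by presburger

definition antiperiodic :: "int \<Rightarrow> int \<Rightarrow> int" where
  "antiperiodic c k = spike (k - c) + spike (k + 1 + c)"

lemma antiperiodic_add_6: "antiperiodic c (k + 6) = - antiperiodic c k"
  using spike_add_6[of "k - c"] spike_add_6[of "k + 1 + c"]
  by (simp add: antiperiodic_def algebra_simps)

lemma antiperiodic_reflect: "antiperiodic c (- 1 - k) = antiperiodic c k"
  using spike_minus[of "k - c"] spike_minus[of "k + 1 + c"]
  by (simp add: antiperiodic_def algebra_simps)

lemma antiperiodic_shift: "antiperiodic c (6 * int n + k) = (-1) ^ n * antiperiodic c k"
proof (induction n)
  case (Suc n)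
  have "6 * int (Suc n) + k = (6 * int n + k) + 6" by simp
  then show ?case
    using Suc by (simp only: antiperiodic_add_6 power_Suc mult_minus1 mult_minus_left mult_1)
qed simp

definition alternating :: "int \<Rightarrow> int" where
  "alternating j = (if even j then 2 * j + 1 else - (2 * j + 1))"

text \<open>
  A sequence \<open>(-1)\<^sup>j q j\<close> is invariant under \<open>j \<mapsto> -1 - j\<close> if and only if the polynomial \<open>q\<close> is odd
  about \<open>-1/2\<close>.  Among the cubic \<open>q\<close> admitted by the quadruple root \<open>-1\<close> this leaves the
  multiples of \<open>2j + 1\<close> by a constant or by \<open>j (j + 1)\<close>, and their combinations.
\<close>
definition null_vec :: "nat \<Rightarrow> int \<Rightarrow> int" where
  "null_vec k j =
    (if k < 3 then antiperiodic (int k) j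
     else if k = 3 then alternating j else alternating j * (j * (j + 1)))"

text \<open>
  The positive part \<open>1, 4, 6, 4, 1\<close> of the band, at the offsets \<open>1, ..., 5\<close>, equals the negative
  part shifted by 6; hence the two cancel on sequences with \<open>v (k + 6) = - v k\<close>.  On the other two
  vectors the factor \<open>(z + 1)\<^sup>4\<close> takes fourth differences of cubic polynomials.
\<close>
lemma band_convolution_null_vec:
  assumes "k < 5"
  shows "(\<Sum>m = - 5..5. band 4 m * null_vec k (i + m)) = 0"
proof -
  have S: "{- 5..5} = {-5, -4, -3, -2, -1, 0, 1, 2, 3, 4, 5 :: int}"
    by (simp add: set_eq_iff) presburger
  have "(\<Sum>m = - 5..5. band 4 m * null_vec k (i + m)) =
     null_vec k (i - 5) + 4 * null_vec k (i - 4) + 6 * null_vec k (i - 3) + 4 * null_vec k (i - 2)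
    + null_vec k (i - 1) + null_vec k (i + 1) + 4 * null_vec k (i + 2) + 6 * null_vec k (i + 3)
    + 4 * null_vec k (i + 4) + null_vec k (i + 5)"
    unfolding S by (simp add: band_def eval_nat_numeral)
  also have "\<dots> = 0"
  proof (cases "k < 3")
    case True
    show ?thesis
      using antiperiodic_add_6[of "int k" "i - 1"] antiperiodic_add_6[of "int k" "i - 2"]
        antiperiodic_add_6[of "int k" "i - 3"] antiperiodic_add_6[of "int k" "i - 4"]
        antiperiodic_add_6[of "int k" "i - 5"] True
      by (simp add: null_vec_def add.commute)
  next
    case False
    then show ?thesis
      by (cases "even i") (simp_all add: null_vec_def alternating_def algebra_simps)
  qed
  finally show ?thesis .
qed

lemma null_vec_reflect: "k < 5 \<Longrightarrow> null_vec k (- 1 - j) = null_vec k j"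
  using antiperiodic_reflect[of "int k" j]
  by (cases "k < 3") (auto simp: null_vec_def alternating_def algebra_simps)

section \<open>Evaluation of the window determinants\<close>

lemma det_mat_Suc:
  "det (mat (Suc n) (Suc n) f) = (\<Sum>i<Suc n. f (i, 0) * ((-1) ^ i *
     det (mat n n (\<lambda>(a, b). f (if a < i then a else Suc a, Suc b)))))"
proof -
  have "mat_delete (mat (Suc n) (Suc n) f) i 0 = mat n n (\<lambda>(a, b). f (if a < i then a else Suc a, Suc b))"
    if "i < Suc n" for i
    by (rule eq_matI) (auto simp: mat_delete_def)
  then show ?thesis
    by (subst laplace_expansion_column[of _ "Suc n" 0]) (auto simp: cofactor_def intro!: sum.cong)
qed

lemma det_mat_2: "det (mat 2 2 f) = f (0, 0) * f (1, 1) - f (1, 0) * f (0, 1)"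
  using det_mat_Suc[of 1 f] by (simp add: numeral_2_eq_2 det_single)

lemma det_mat_3: "det (mat 3 3 f) =
    f (0, 0) * det (mat 2 2 (\<lambda>(a, b). f (Suc a, Suc b)))
    - f (1, 0) * det (mat 2 2 (\<lambda>(a, b). f (if a < 1 then a else Suc a, Suc b)))
    + f (2, 0) * det (mat 2 2 (\<lambda>(a, b). f (if a < 2 then a else Suc a, Suc b)))"
  using det_mat_Suc[of 2 f] by (simp add: lessThan_nat_numeral lessThan_Suc)

lemma det_mat_4: "det (mat 4 4 f) =
    f (0, 0) * det (mat 3 3 (\<lambda>(a, b). f (Suc a, Suc b)))
    - f (1, 0) * det (mat 3 3 (\<lambda>(a, b). f (if a < 1 then a else Suc a, Suc b)))
    + f (2, 0) * det (mat 3 3 (\<lambda>(a, b). f (if a < 2 then a else Suc a, Suc b)))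
    - f (3, 0) * det (mat 3 3 (\<lambda>(a, b). f (if a < 3 then a else Suc a, Suc b)))"
  using det_mat_Suc[of 3 f] by (simp add: lessThan_nat_numeral lessThan_Suc)

lemma det_mat_5: "det (mat 5 5 f) =
    f (0, 0) * det (mat 4 4 (\<lambda>(a, b). f (Suc a, Suc b)))
    - f (1, 0) * det (mat 4 4 (\<lambda>(a, b). f (if a < 1 then a else Suc a, Suc b)))
    + f (2, 0) * det (mat 4 4 (\<lambda>(a, b). f (if a < 2 then a else Suc a, Suc b)))
    - f (3, 0) * det (mat 4 4 (\<lambda>(a, b). f (if a < 3 then a else Suc a, Suc b)))
    + f (4, 0) * det (mat 4 4 (\<lambda>(a, b). f (if a < 4 then a else Suc a, Suc b)))"
  using det_mat_Suc[of 4 f] by (simp add: lessThan_nat_numeral lessThan_Suc)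

text \<open>
  The expansion into products of entries is completed for an abstract \<open>f\<close>, so that concrete
  entries are only ever unfolded at literal indices, where most of them vanish.
\<close>
lemmas det_mat_5_expanded = det_mat_5[unfolded det_mat_4 det_mat_3 det_mat_2 prod.case, simplified]

text \<open>
  The Casoratian of the five kernel vectors, the discrete analogue of a Wronskian.
\<close>
definition window :: "nat \<Rightarrow> int" where
  "window n = det (mat 5 5 (\<lambda>(j, k). null_vec k (int (n + j))))"

lemma antiperiodic_shift':
  "antiperiodic c (6 * int n) = (-1) ^ n * antiperiodic c 0"
  "antiperiodic c (k + 6 * int n) = (-1) ^ n * antiperiodic c k"
  using antiperiodic_shift[of c n 0] antiperiodic_shift[of c n k] by (simp_all add: add.commute)

lemmas antiperiodic_numeral =
  antiperiodic_def[of _ 0] antiperiodic_def[of _ 1] antiperiodic_def[of _ "numeral w" for w]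

lemma window_values:
  "window (6 * n) = - 24 * (- 1) ^ n"
  "window (6 * n + 1) = 24 * (- 1) ^ n"
  "window (6 * n + 2) = - 24 * (- 1) ^ n * (int n + 1) * (144 * int n ^ 2 + 72 * int n - 19)"
  "window (6 * n + 3) = - 24 * (- 1) ^ n * 144 * (int n + 1) ^ 2"
  "window (6 * n + 4) = - 24 * (- 1) ^ n * 144 * (int n + 1) ^ 2"
  "window (6 * n + 5) = 24 * (- 1) ^ n * (int n + 1) * (144 * int n ^ 2 + 504 * int n + 413)"
proof -
  define s :: int where "s = (-1) ^ n"
  \<comment> \<open>Each of the three antiperiodic columns contributes a factor \<open>s\<close>, and \<open>s * s = 1\<close>.\<close>
  have s: "s * (s * x) = x" for x unfolding s_def by (cases "even n") simp_all
  note ev = window_def det_mat_5_expanded null_vec_def antiperiodic_shift antiperiodic_shift'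
    antiperiodic_numeral spike_def s_def[symmetric]
  show "window (6 * n) = - 24 * (- 1) ^ n"
    by (simp add: ev, simp add: alternating_def, simp add: s algebra_simps power2_eq_square)
  show "window (6 * n + 1) = 24 * (- 1) ^ n"
    by (simp add: ev, simp add: alternating_def, simp add: s algebra_simps power2_eq_square)
  show "window (6 * n + 2) = - 24 * (- 1) ^ n * (int n + 1) * (144 * int n ^ 2 + 72 * int n - 19)"
    by (simp add: ev, simp add: alternating_def, simp add: s algebra_simps power2_eq_square)
  show "window (6 * n + 3) = - 24 * (- 1) ^ n * 144 * (int n + 1) ^ 2"
    by (simp add: ev, simp add: alternating_def, simp add: s algebra_simps power2_eq_square)
  show "window (6 * n + 4) = - 24 * (- 1) ^ n * 144 * (int n + 1) ^ 2"
    by (simp add: ev, simp add: alternating_def, simp add: s algebra_simps power2_eq_square)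
  show "window (6 * n + 5) = 24 * (- 1) ^ n * (int n + 1) * (144 * int n ^ 2 + 504 * int n + 413)"
    by (simp add: ev, simp add: alternating_def, simp add: s algebra_simps power2_eq_square)
qed

section \<open>The Hankel determinants\<close>

text \<open>The factor \<open>-24\<close> is the window determinant at \<open>0\<close>.\<close>
lemma hankel_det_G6: "- 24 * hankel_det n (G 6) = (-1) ^ n * window n"
proof -
  have "window 0 = - 24"
    using window_values(1)[of 0] by simp
  have "det (mat n n (\<lambda>(i, j). folded (band 4) i j)) * det (mat 5 5 (\<lambda>(j, k). null_vec k (int j))) =
    (-1) ^ (5 * n) * det (mat 5 5 (\<lambda>(j, k). null_vec k (int (n + j))))"
  proof (rule det_banded)
    fix i k :: nat assume k: "k < 5"
    have "(\<Sum>j\<le>i + 5. folded (band 4) i j * null_vec k (int j)) =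
      (\<Sum>m = - int 5..int 5. band 4 m * null_vec k (int i + m))"
      by (rule sum_folded_eq_convolution) (auto simp: band_def null_vec_reflect[OF k])
    also have "\<dots> = 0" using band_convolution_null_vec[OF k] by simp
    finally show "(\<Sum>j\<le>i + 5. folded (band 4) i j * null_vec k (int j)) = 0" .
  qed (auto simp: folded_def band_def nat_diff_distrib nat_add_distrib binomial_eq_0)
  moreover have "(- 1 :: int) ^ (5 * n) = (- 1) ^ n"
    by (simp add: minus_one_power_iff)
  ultimately show ?thesis
    using hankel_det_G[of n 4] \<open>window 0 = - 24\<close> by (simp add: window_def mult.commute)
qed

theorem theorem19:
  fixes n :: nat
  shows "hankel_det (6 * n) (G 6) = (-1) ^ n \<and>
    hankel_det (6 * n + 1) (G 6) = (-1) ^ n \<and>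
    hankel_det (6 * n + 2) (G 6) =
      (-1) ^ n * (int n + 1) * (144 * int n ^ 2 + 72 * int n - 19) \<and>
    hankel_det (6 * n + 3) (G 6) = (-1) ^ (n + 1) * 144 * (int n + 1) ^ 2 \<and>
    - hankel_det (6 * n + 4) (G 6) = (-1) ^ (n + 1) * 144 * (int n + 1) ^ 2 \<and>
    hankel_det (6 * n + 5) (G 6) =
      (-1) ^ n * (int n + 1) * (144 * int n ^ 2 + 504 * int n + 413)"
proof -
  have "hankel_det (6 * n) (G 6) = (- 1) ^ n"
    using hankel_det_G6[of "6 * n"] unfolding window_values by (simp add: power_mult)
  moreover have "hankel_det (6 * n + 1) (G 6) = (- 1) ^ n"
    using hankel_det_G6[of "6 * n + 1"] unfolding window_values by (simp add: power_mult)
  moreover have "hankel_det (6 * n + 2) (G 6) =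
      (- 1) ^ n * (int n + 1) * (144 * int n ^ 2 + 72 * int n - 19)"
    using hankel_det_G6[of "6 * n + 2"] unfolding window_values by (simp add: power_add power_mult)
  moreover have "hankel_det (6 * n + 3) (G 6) = (- 1) ^ (n + 1) * 144 * (int n + 1) ^ 2"
    using hankel_det_G6[of "6 * n + 3"] unfolding window_values by (simp add: power_add power_mult)
  moreover have "- hankel_det (6 * n + 4) (G 6) = (- 1) ^ (n + 1) * 144 * (int n + 1) ^ 2"
    using hankel_det_G6[of "6 * n + 4"] unfolding window_values by (simp add: power_add power_mult)
  moreover have "hankel_det (6 * n + 5) (G 6) =
      (- 1) ^ n * (int n + 1) * (144 * int n ^ 2 + 504 * int n + 413)"
    using hankel_det_G6[of "6 * n + 5"] unfolding window_values by (simp add: power_add power_mult)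
  ultimately show ?thesis by blast
qed

end
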